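(* Let $n\geq 4$, let $\lambda_2,\ldots,\lambda_{n-2}$ be real numbers with $1\geq\lambda_2\geq\cdots\geq\lambda_{n-2}\geq -1$, and let $a,b$ be real numbers such that $1+\lambda_2+\cdots+\lambda_{n-2}+2a\geq 0$ and $|a+Ib|\leq 1$. Put $$S=\frac{1}{n}+\sum_{k=2}^{n-2}\frac{\lambda_k}{(n-k+2)(n-k+1)}.$$ If $$S+\frac{2a}{3}\geq 0,\qquad S-\frac{a}{3}-\frac{b\sqrt{3}}{3}\geq 0,\qquad S-\frac{a}{3}+\frac{b\sqrt{3}}{3}\geq 0,$$ and $$\frac{1}{n}+\sum_{k=2}^{n-3}\frac{\lambda_k}{(n-k+2)(n-k+1)}+\frac{3\lambda_{n-2}}{4}\geq 0,$$ then $(1,\lambda_2,\ldots,\lambda_{n-2},a+Ib,a-Ib)$ is the spectrum of an $n\times n$ doubly stochastic matrix.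
   Context: $I$ denotes the imaginary unit. An $n\times n$ real matrix is doubly stochastic if all its entries are nonnegative and each row sum and each column sum equals $1$. The spectrum is the list of eigenvalues counted with algebraic multiplicity. Empty sums are $0$; the sum in $S$ is $\frac{\lambda_2}{n(n-1)}+\frac{\lambda_3}{(n-1)(n-2)}+\cdots+\frac{\lambda_{n-2}}{(4)(3)}$. *)

theory Defs
  imports Complex_Main "HOL-Computational_Algebra.Computational_Algebra"
    "Jordan_Normal_Form.Char_Poly"
begin

definition doubly_stochastic :: "nat \<Rightarrow> real mat \<Rightarrow> bool" where
  "doubly_stochastic n A \<longleftrightarrow>
     A \<in> carrier_mat n n \<and>
     (\<forall>i<n. \<forall>j<n. A $$ (i, j) \<ge> 0) \<and>
     (\<forall>i<n. (\<Sum>j<n. A $$ (i, j)) = 1) \<and>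
     (\<forall>j<n. (\<Sum>i<n. A $$ (i, j)) = 1)"

(* The order of the list is immaterial: every complex number z occurs in it exactly
   as often as its multiplicity as a root of the characteristic polynomial. *)
definition has_spectrum :: "real mat \<Rightarrow> complex list \<Rightarrow> bool" where
  "has_spectrum A zs \<longleftrightarrow> mset zs = proots (char_poly (map_mat complex_of_real A))"

end

theory Submission
  imports Defs
begin

text \<open>
  Index rows and columns by \<open>0, \<dots>, n - 1\<close> and attach the eigenvalue \<open>m p = l (n + 1 - p)\<close>
  to the index \<open>p \<ge> 3\<close>. The matrix is built from its spectral decomposition in the
  orthogonal basis formed by the all-ones vector (eigenvalue \<open>1\<close>), the vectors
  \<open>(1, \<omega>, \<omega>\<^sup>2, 0, \<dots>, 0)\<close> and \<open>(1, \<omega>\<^sup>2, \<omega>, 0, \<dots>, 0)\<close> with \<open>\<omega>\<close> a primitive cube root of unity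
  (eigenvalues \<open>a + \<i>b\<close> and \<open>a - \<i>b\<close>), and the Soules vectors \<open>(1, \<dots>, 1, -p, 0, \<dots>, 0)\<close>
  with \<open>p\<close> leading ones (eigenvalue \<open>m p\<close>, for \<open>3 \<le> p < n\<close>).
  The ones vector and the Soules vectors contribute a real symmetric matrix whose entries are
  governed by the partial sums \<open>s p = 1/n + (\<Sum>q = p+1..<n. m q / ((q+1) q))\<close>, and the
  two complex vectors contribute a real circulant block in the upper left \<open>3 \<times> 3\<close> corner.

  Because the basis is orthogonal and consists of eigenvectors, the characteristic polynomial
  splits as prescribed (\<open>char_poly_orthogonal_eigenvectors\<close>). Row and column sums
  are \<open>1\<close> since the ones vector is an eigenvector of the matrix and, after replacing \<open>b\<close> by
  \<open>-b\<close>, of its transpose. For nonnegativity there are three kinds of entries.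
  Those of the \<open>3 \<times> 3\<close> block are exactly the three hypotheses on \<open>S = s 2\<close>.
  The other off-diagonal entries \<open>s p - m p / (p+1)\<close> are nonnegative because \<open>m\<close> is increasing and
  bounded by \<open>1\<close>: the weights in \<open>s p\<close> sum to \<open>1 / (p+1)\<close> and are attached to values \<open>\<ge> m p\<close>
  (\<open>offdiagonal_nonneg\<close>). The other diagonal entries \<open>s p + m p * p / (p+1)\<close> increase with \<open>p\<close>
  (\<open>diagonal_nonneg\<close>), and the first one, \<open>p = 3\<close>, is the last hypothesis.
\<close>

section \<open>Characteristic polynomials from orthogonal eigenvectors\<close>

lemma char_poly_orthogonal_eigenvectors:
  fixes A :: "complex mat" and v :: "nat \<Rightarrow> nat \<Rightarrow> complex" and d :: "nat \<Rightarrow> complex"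
  assumes A: "A \<in> carrier_mat n n"
    and eig: "\<And>p i. p < n \<Longrightarrow> i < n \<Longrightarrow> (\<Sum>j<n. A $$ (i, j) * v p j) = d p * v p i"
    and orth: "\<And>p q. p < n \<Longrightarrow> q < n \<Longrightarrow> p \<noteq> q \<Longrightarrow> (\<Sum>j<n. cnj (v p j) * v q j) = 0"
    and nz: "\<And>p. p < n \<Longrightarrow> \<exists>j<n. v p j \<noteq> 0"
  shows "char_poly A = (\<Prod>p\<leftarrow>[0..<n]. [:- d p, 1:])"
proof -
  define N where "N p = (\<Sum>j<n. cnj (v p j) * v p j)" for p
  define P where "P = mat n n (\<lambda>(i, p). v p i)"
  define Q where "Q = mat n n (\<lambda>(p, j). cnj (v p j) / N p)"
  define D where "D = mat n n (\<lambda>(i, j). if i = j then d i else 0)"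
  have carrier: "P \<in> carrier_mat n n" "Q \<in> carrier_mat n n" "D \<in> carrier_mat n n"
    by (auto simp: P_def Q_def D_def)
  have N: "N p \<noteq> 0" if p: "p < n" for p
  proof -
    obtain j where j: "j < n" "v p j \<noteq> 0" using nz[OF p] by blast
    have "0 < (\<Sum>j<n. (cmod (v p j))\<^sup>2)"
      by (rule sum_pos2[of _ j]) (use j in auto)
    moreover have "N p = complex_of_real (\<Sum>j<n. (cmod (v p j))\<^sup>2)"
      unfolding N_def of_real_sum
      by (rule sum.cong) (auto simp: complex_norm_square mult.commute simp del: of_real_power)
    ultimately show ?thesis by (metis less_irrefl of_real_eq_0_iff)
  qed
  have QP: "Q * P = 1\<^sub>m n"
  proof (rule eq_matI)
    fix p q assume "p < dim_row (1\<^sub>m n)" "q < dim_col (1\<^sub>m n)"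
    then have pq: "p < n" "q < n" by auto
    have "(Q * P) $$ (p, q) = (\<Sum>j<n. cnj (v p j) * v q j) / N p"
      using pq by (simp add: P_def Q_def scalar_prod_def sum_divide_distrib atLeast0LessThan)
    then show "(Q * P) $$ (p, q) = 1\<^sub>m n $$ (p, q)"
      using pq N[of p] orth[of p q] by (cases "p = q") (auto simp: N_def)
  qed (use carrier in auto)
  then have PQ: "P * Q = 1\<^sub>m n"
    using mat_mult_left_right_inverse carrier by blast
  have AP: "A * P = P * D"
  proof (rule eq_matI)
    fix i p assume "i < dim_row (P * D)" "p < dim_col (P * D)"
    then have ip: "i < n" "p < n" using carrier by auto
    have "(P * D) $$ (i, p) = (\<Sum>k<n. v k i * (if k = p then d k else 0))"
      using ip by (simp add: P_def D_def scalar_prod_def atLeast0LessThan)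
    also have "\<dots> = (\<Sum>k<n. if k = p then v p i * d p else 0)"
      by (rule sum.cong) auto
    also have "\<dots> = d p * v p i" using ip by simp
    finally show "(A * P) $$ (i, p) = (P * D) $$ (i, p)"
      using ip A eig[of p i] by (simp add: P_def scalar_prod_def atLeast0LessThan)
  qed (use carrier A in auto)
  have "A = A * (P * Q)" using A PQ by simp
  also have "\<dots> = P * D * Q" unfolding AP[symmetric]
    by (rule assoc_mult_mat[symmetric, OF A carrier(1,2)])
  finally have "similar_mat A D"
    using A carrier PQ QP by (intro similar_matI[of _ _ P Q n]) auto
  then have "char_poly A = char_poly D" by (rule char_poly_similar)
  also have "\<dots> = (\<Prod>x\<leftarrow>diag_mat D. [:- x, 1:])"
    by (rule char_poly_upper_triangular[of D n]) (auto simp: D_def)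
  also have "diag_mat D = map d [0..<n]" by (auto simp: diag_mat_def D_def)
  finally show ?thesis by (simp add: o_def)
qed

section \<open>The matrix and its row and column sums\<close>

text \<open>The common value of the contribution of the ones vector and of the Soules vectors
  with index above \<open>p\<close> to every entry whose row and column are at most \<open>p\<close>:
  the Soules vector with index \<open>q\<close> has squared norm \<open>q (q + 1)\<close>.\<close>

definition soules_sum :: "nat \<Rightarrow> (nat \<Rightarrow> real) \<Rightarrow> nat \<Rightarrow> real" where
  "soules_sum n m p = 1 / real n + (\<Sum>q = Suc p..<n. m q / ((real q + 1) * real q))"

text \<open>The real \<open>3 \<times> 3\<close> circulant with eigenvalues \<open>0\<close>, \<open>a + \<i>b\<close> and \<open>a - \<i>b\<close>.\<close>

definition circulant3 :: "real \<Rightarrow> real \<Rightarrow> nat \<Rightarrow> nat \<Rightarrow> real" where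
  "circulant3 a b i j =
     (if i = j then 2 * a / 3
      else if j = Suc i mod 3 then - a / 3 + b * sqrt 3 / 3
      else - a / 3 - b * sqrt 3 / 3)"

text \<open>The entries of the matrix with the spectral decomposition described above.\<close>

definition soules_entry ::
    "nat \<Rightarrow> (nat \<Rightarrow> real) \<Rightarrow> real \<Rightarrow> real \<Rightarrow> nat \<Rightarrow> nat \<Rightarrow> real" where
  "soules_entry n m a b i j =
     (if i < 3 \<and> j < 3 then soules_sum n m 2 + circulant3 a b i j
      else if i = j then soules_sum n m i + m i * real i / (real i + 1)
      else soules_sum n m (max i j) - m (max i j) / (real (max i j) + 1))"

lemma soules_sum_Suc:
  assumes "Suc p < n"
  shows "soules_sum n m p = soules_sum n m (Suc p) + m (Suc p) / ((real p + 2) * (real p + 1))"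
  using assms unfolding soules_sum_def
  by (subst sum.atLeast_Suc_lessThan) (auto simp: algebra_simps)

lemma soules_sum_last: "soules_sum (Suc p) m p = 1 / real (Suc p)"
  by (simp add: soules_sum_def)

lemma lessThan_3: "{..<3::nat} = {0, 1, 2}"
  by auto

lemma less_3_cases: "i < 3 \<longleftrightarrow> i = 0 \<or> i = 1 \<or> i = (2::nat)"
  by auto

lemma circulant3_transpose:
  assumes "i < 3" "j < 3"
  shows "circulant3 a b j i = circulant3 a (- b) i j"
  using assms unfolding less_3_cases by (elim disjE) (simp_all add: circulant3_def)

lemma soules_entry_transpose:
  "soules_entry n m a b j i = soules_entry n m a (- b) i j"
proof (cases "i < 3 \<and> j < 3")
  case True
  then show ?thesis by (simp add: soules_entry_def circulant3_transpose[of i j])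
next
  case False
  then show ?thesis by (auto simp: soules_entry_def max.commute)
qed

lemma circulant3_row_sum: "i < 3 \<Longrightarrow> (\<Sum>j<3. circulant3 a b i j) = 0"
  unfolding lessThan_3 less_3_cases by (elim disjE) (simp_all add: circulant3_def)

text \<open>The vector of \<open>p\<close> leading ones is an eigenvector of the leading \<open>p \<times> p\<close> block.\<close>

lemma soules_partial_row_sum:
  assumes "3 \<le> p" "p \<le> n" "i < p"
  shows "(\<Sum>j<p. soules_entry n m a b i j) = real p * soules_sum n m (p - 1)"
  using assms
proof (induction p arbitrary: i rule: nat_induct_at_least)
  case base
  then have "(\<Sum>j<3. soules_entry n m a b i j)
      = (\<Sum>j<3. soules_sum n m 2 + circulant3 a b i j)"
    by (intro sum.cong) (auto simp: soules_entry_def)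
  also have "\<dots> = 3 * soules_sum n m 2"
    using base circulant3_row_sum[of i a b] by (simp add: sum.distrib)
  finally show ?case by simp
next
  case (Suc p)
  obtain r where r: "p = Suc r" using Suc.hyps by (cases p) auto
  have step: "soules_sum n m r = soules_sum n m p + m p / ((real p + 1) * real p)"
    using soules_sum_Suc[of r n m] Suc.prems unfolding r by (simp add: algebra_simps)
  have p0: "real p > 0" using r by simp
  show ?case
  proof (cases "i < p")
    case True
    have "(\<Sum>j<Suc p. soules_entry n m a b i j)
        = real p * soules_sum n m r + (soules_sum n m p - m p / (real p + 1))"
      using Suc True r by (simp add: soules_entry_def max_def)
    also have "\<dots> = (real p + 1) * soules_sum n m p"
    proof -
      have "real p * (m p / ((real p + 1) * real p)) = m p / (real p + 1)"
        using p0 by simp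
      then show ?thesis unfolding step distrib_left distrib_right by linarith
    qed
    finally show ?thesis by (simp add: algebra_simps)
  next
    case False
    then have i: "i = p" using Suc.prems by simp
    have "(\<Sum>j<p. soules_entry n m a b p j) = (\<Sum>j<p. soules_sum n m p - m p / (real p + 1))"
      using Suc.hyps by (intro sum.cong) (auto simp: soules_entry_def max_def)
    then have "(\<Sum>j<Suc p. soules_entry n m a b i j)
        = real p * (soules_sum n m p - m p / (real p + 1))
          + (soules_sum n m p + m p * real p / (real p + 1))"
      using Suc.hyps i by (simp add: soules_entry_def)
    then show ?thesis by (simp add: algebra_simps)
  qed
qed

corollary soules_row_sum:
  assumes "3 \<le> n" "i < n"
  shows "(\<Sum>j<n. soules_entry n m a b i j) = 1"
proof -
  have "soules_sum n m (n - 1) = 1 / real n"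
    using soules_sum_last[of "n - 1" m] assms by simp
  then show ?thesis using soules_partial_row_sum[of n n i m a b] assms by simp
qed

corollary soules_col_sum:
  assumes "3 \<le> n" "j < n"
  shows "(\<Sum>i<n. soules_entry n m a b i j) = 1"
proof -
  have "(\<Sum>i<n. soules_entry n m a b i j) = (\<Sum>i<n. soules_entry n m a (- b) j i)"
    by (subst soules_entry_transpose) simp
  then show ?thesis using soules_row_sum assms by simp
qed

section \<open>The eigenvector basis\<close>

text \<open>The primitive cube root of unity \<open>exp (2 \<pi> \<i> / 3)\<close>.\<close>

definition omega3 :: complex where
  "omega3 = Complex (- 1 / 2) (sqrt 3 / 2)"

text \<open>The eigenvector with index \<open>p\<close>, given by its coordinates \<open>j\<close>: the ones vector
  for \<open>p = 0\<close>, the eigenvectors of the circulant block for \<open>p = 1, 2\<close> and the Soules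
  vectors for \<open>p \<ge> 3\<close>. The vectors are not normalized.\<close>

definition soules_vec :: "nat \<Rightarrow> nat \<Rightarrow> complex" where
  "soules_vec p j =
     (if p = 0 then 1
      else if p = 1 then (if j < 3 then omega3 ^ j else 0)
      else if p = 2 then (if j < 3 then cnj omega3 ^ j else 0)
      else if j < p then 1
      else if j = p then - of_nat p
      else 0)"

text \<open>The eigenvalue that belongs to \<open>soules_vec p\<close>.\<close>

definition soules_eigenvalue :: "(nat \<Rightarrow> real) \<Rightarrow> real \<Rightarrow> real \<Rightarrow> nat \<Rightarrow> complex" where
  "soules_eigenvalue m a b p =
     (if p = 0 then 1
      else if p = 1 then complex_of_real a + \<i> * complex_of_real b
      else if p = 2 then complex_of_real a - \<i> * complex_of_real b
      else complex_of_real (m p))"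

lemma omega3_square: "omega3\<^sup>2 = cnj omega3"
  by (simp add: omega3_def complex_eq_iff power2_eq_square)

lemma cnj_omega3_square: "(cnj omega3)\<^sup>2 = omega3"
  by (simp add: omega3_def complex_eq_iff power2_eq_square)

lemma sum_lessThan_extend:
  fixes f :: "nat \<Rightarrow> 'a::comm_monoid_add"
  assumes "k \<le> n" "\<And>j. k \<le> j \<Longrightarrow> j < n \<Longrightarrow> f j = 0"
  shows "(\<Sum>j<n. f j) = (\<Sum>j<k. f j)"
  using assms by (intro sum.mono_neutral_right) auto

lemma soules_vec_sum3: "p = 1 \<or> p = 2 \<Longrightarrow> (\<Sum>j<3. soules_vec p j) = 0"
  unfolding lessThan_3
  by (auto simp: soules_vec_def omega3_square cnj_omega3_square)
     (simp_all add: omega3_def complex_eq_iff)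

lemma soules_vec_nonzero: "soules_vec p 0 \<noteq> 0"
  by (simp add: soules_vec_def)

lemma soules_vec_orthogonal_less:
  assumes "3 \<le> n" "p < q" "q < n"
  shows "(\<Sum>j<n. cnj (soules_vec p j) * soules_vec q j) = 0"
proof (cases "3 \<le> q")
  case True
  have "(\<Sum>j<n. cnj (soules_vec p j) * soules_vec q j)
      = (\<Sum>j<Suc q. cnj (soules_vec p j) * soules_vec q j)"
    using assms True by (intro sum_lessThan_extend) (auto simp: soules_vec_def)
  also have "\<dots> = (\<Sum>j<q. cnj (soules_vec p j)) - of_nat q * cnj (soules_vec p q)"
    using True by (simp add: soules_vec_def)
  also have "\<dots> = 0"
  proof -
    consider "p = 0" | "p = 1 \<or> p = 2" | "3 \<le> p" by linarith
    then show ?thesis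
    proof cases
      case 1
      then show ?thesis by (simp add: soules_vec_def)
    next
      case 2
      then have "(\<Sum>j<q. soules_vec p j) = 0"
        using soules_vec_sum3[of p] True
        by (subst sum_lessThan_extend[of 3]) (auto simp: soules_vec_def)
      then have "(\<Sum>j<q. cnj (soules_vec p j)) = 0"
        by (metis cnj_sum complex_cnj_zero)
      then show ?thesis using 2 True by (auto simp: soules_vec_def)
    next
      case 3
      have "(\<Sum>j<q. soules_vec p j) = (\<Sum>j<Suc p. soules_vec p j)"
        using 3 assms by (intro sum_lessThan_extend) (auto simp: soules_vec_def)
      also have "\<dots> = 0" using 3 by (simp add: soules_vec_def)
      finally have "(\<Sum>j<q. cnj (soules_vec p j)) = 0"
        by (metis cnj_sum complex_cnj_zero)
      then show ?thesis using 3 assms by (auto simp: soules_vec_def)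
    qed
  qed
  finally show ?thesis .
next
  case False
  then have q: "q = 1 \<or> q = 2" using assms by auto
  have "(\<Sum>j<n. cnj (soules_vec p j) * soules_vec q j)
      = (\<Sum>j<3. cnj (soules_vec p j) * soules_vec q j)"
    using assms q by (intro sum_lessThan_extend) (auto simp: soules_vec_def)
  also have "\<dots> = 0"
  proof (cases "p = 0")
    case True
    then show ?thesis using soules_vec_sum3[OF q] by (simp add: soules_vec_def)
  next
    case False
    then have "p = 1" "q = 2" using q assms by auto
    then show ?thesis
      unfolding lessThan_3
      by (simp add: soules_vec_def omega3_square cnj_omega3_square)
         (simp add: omega3_def complex_eq_iff)
  qed
  finally show ?thesis .
qed

lemma soules_vec_orthogonal:
  assumes "3 \<le> n" "p < n" "q < n" "p \<noteq> q"
  shows "(\<Sum>j<n. cnj (soules_vec p j) * soules_vec q j) = 0"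
proof (cases "p < q")
  case True
  then show ?thesis using soules_vec_orthogonal_less assms by blast
next
  case False
  then have "(\<Sum>j<n. cnj (soules_vec q j) * soules_vec p j) = 0"
    using soules_vec_orthogonal_less assms by simp
  then have "cnj (\<Sum>j<n. cnj (soules_vec q j) * soules_vec p j) = 0" by simp
  then show ?thesis by (simp add: mult.commute)
qed

lemma circulant3_eigenvector:
  assumes "i < 3" "p = 1 \<or> p = 2"
  shows "(\<Sum>j<3. complex_of_real (circulant3 a b i j) * soules_vec p j)
    = soules_eigenvalue m a b p * soules_vec p i"
proof -
  have omega: "Re omega3 = - 1 / 2" "Im omega3 = sqrt 3 / 2"
    by (simp_all add: omega3_def)
  have sqrt3: "x * sqrt 3 * sqrt 3 = 3 * x" for x by simp
  show ?thesis
    using assms unfolding lessThan_3 less_3_cases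
    by (elim disjE,
        simp_all add: circulant3_def soules_vec_def soules_eigenvalue_def
          omega3_square cnj_omega3_square,
        simp_all add: omega complex_eq_iff,
        simp_all add: algebra_simps add_divide_distrib diff_divide_distrib sqrt3)
qed

text \<open>A row meets the support of an eigenvector in one of three ways. A row above \<open>p\<close> meets
  the Soules vector with index \<open>p\<close> in the leading block, where partial row sums are known. A row
  below the support of a vector other than the ones vector is constant on that support, so it
  annihilates the vector. Row \<open>p\<close> is a direct computation.\<close>

lemma soules_eigenvector:
  assumes n: "3 \<le> n" and p: "p < n" and i: "i < n"
  shows "(\<Sum>j<n. complex_of_real (soules_entry n m a b i j) * soules_vec p j)
    = soules_eigenvalue m a b p * soules_vec p i"
proof -
  consider "p = 0" | "p = 1 \<or> p = 2" | "3 \<le> p" by linarith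
  then show ?thesis
  proof cases
    case 1
    then show ?thesis
      using soules_row_sum[OF n i, of m a b]
      by (simp add: soules_vec_def soules_eigenvalue_def flip: of_real_sum)
  next
    case 2
    have "(\<Sum>j<n. complex_of_real (soules_entry n m a b i j) * soules_vec p j)
        = (\<Sum>j<3. complex_of_real (soules_entry n m a b i j) * soules_vec p j)"
      using n 2 by (intro sum_lessThan_extend) (auto simp: soules_vec_def)
    also have "\<dots> = soules_eigenvalue m a b p * soules_vec p i"
    proof (cases "i < 3")
      case True
      have "(\<Sum>j<3. complex_of_real (soules_entry n m a b i j) * soules_vec p j)
          = complex_of_real (soules_sum n m 2) * (\<Sum>j<3. soules_vec p j)
            + (\<Sum>j<3. complex_of_real (circulant3 a b i j) * soules_vec p j)"
        using True unfolding sum_distrib_left sum.distrib[symmetric]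
        by (intro sum.cong) (auto simp: soules_entry_def algebra_simps)
      then show ?thesis
        using circulant3_eigenvector[OF True 2] soules_vec_sum3[OF 2] by simp
    next
      case False
      have "(\<Sum>j<3. complex_of_real (soules_entry n m a b i j) * soules_vec p j)
          = complex_of_real (soules_sum n m i - m i / (real i + 1)) * (\<Sum>j<3. soules_vec p j)"
        using False unfolding sum_distrib_left
        by (intro sum.cong) (auto simp: soules_entry_def max_def)
      then show ?thesis using soules_vec_sum3[OF 2] 2 False by (auto simp: soules_vec_def)
    qed
    finally show ?thesis .
  next
    case 3
    have "(\<Sum>j<n. complex_of_real (soules_entry n m a b i j) * soules_vec p j)
        = (\<Sum>j<Suc p. complex_of_real (soules_entry n m a b i j) * soules_vec p j)"
      using p 3 by (intro sum_lessThan_extend) (auto simp: soules_vec_def)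
    also have "\<dots> = complex_of_real
        ((\<Sum>j<p. soules_entry n m a b i j) - real p * soules_entry n m a b i p)"
      using 3 by (simp add: soules_vec_def)
    finally have sum: "(\<Sum>j<n. complex_of_real (soules_entry n m a b i j) * soules_vec p j)
        = complex_of_real ((\<Sum>j<p. soules_entry n m a b i j) - real p * soules_entry n m a b i p)" .
    consider "i < p" | "i = p" | "p < i" by linarith
    then show ?thesis
    proof cases
      case 1
      have "soules_sum n m (p - 1) = soules_sum n m p + m p / ((real p + 1) * real p)"
        using soules_sum_Suc[of "p - 1" n m] 3 p by (simp add: of_nat_diff algebra_simps)
      then have "real p * soules_sum n m (p - 1)
          - real p * (soules_sum n m p - m p / (real p + 1))
          = real p * (m p / ((real p + 1) * real p)) + real p * (m p / (real p + 1))"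
        by (simp add: distrib_left right_diff_distrib)
      also have "real p * (m p / ((real p + 1) * real p)) = m p / (real p + 1)"
        using 3 by simp
      also have "m p / (real p + 1) + real p * (m p / (real p + 1)) = m p"
        using 3 by (simp add: divide_simps) (simp add: algebra_simps)
      finally have "real p * soules_sum n m (p - 1)
          - real p * (soules_sum n m p - m p / (real p + 1)) = m p" .
      then show ?thesis
        unfolding sum using soules_partial_row_sum[of p n i m a b] 1 3 p
        by (simp add: soules_entry_def max_def soules_vec_def soules_eigenvalue_def
             flip: of_real_mult of_real_diff of_real_add)
    next
      case 2
      have "(\<Sum>j<p. soules_entry n m a b p j) = (\<Sum>j<p. soules_sum n m p - m p / (real p + 1))"
        using 3 by (intro sum.cong) (auto simp: soules_entry_def max_def)
      then have "(\<Sum>j<p. soules_entry n m a b i j) - real p * soules_entry n m a b i p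
          = - (real p * (m p / (real p + 1) + m p * real p / (real p + 1)))"
        using 2 3 by (simp add: soules_entry_def distrib_left right_diff_distrib)
      also have "m p / (real p + 1) + m p * real p / (real p + 1) = m p"
        by (simp add: divide_simps) (simp add: algebra_simps)
      finally have "(\<Sum>j<p. soules_entry n m a b i j) - real p * soules_entry n m a b i p
          = - (real p * m p)" .
      then show ?thesis unfolding sum using 2 3
        by (simp add: soules_vec_def soules_eigenvalue_def)
    next
      case c: 3
      have "(\<Sum>j<p. soules_entry n m a b i j) = (\<Sum>j<p. soules_sum n m i - m i / (real i + 1))"
        using 3 c by (intro sum.cong) (auto simp: soules_entry_def max_def)
      then have "(\<Sum>j<p. soules_entry n m a b i j) - real p * soules_entry n m a b i p = 0"
        using c 3 by (simp add: soules_entry_def max_def)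
      then show ?thesis unfolding sum using c 3
        by (simp add: soules_vec_def soules_eigenvalue_def)
    qed
  qed
qed

lemma soules_spectrum:
  assumes "3 \<le> n"
  shows "has_spectrum (mat n n (\<lambda>(i, j). soules_entry n m a b i j))
    (map (soules_eigenvalue m a b) [0..<n])"
proof -
  let ?A = "map_mat complex_of_real (mat n n (\<lambda>(i, j). soules_entry n m a b i j))"
  have "char_poly ?A = (\<Prod>p\<leftarrow>[0..<n]. [:- soules_eigenvalue m a b p, 1:])"
  proof (rule char_poly_orthogonal_eigenvectors)
    show "\<exists>j<n. soules_vec p j \<noteq> 0" if "p < n" for p
      using soules_vec_nonzero[of p] assms by (intro exI[of _ 0]) auto
  qed (use assms soules_eigenvector[OF assms, of _ _ m a b] soules_vec_orthogonal[OF assms]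
       in auto)
  moreover have "proots (\<Prod>x\<leftarrow>xs. [:- x, 1:]) = mset xs" for xs :: "complex list"
  proof (induction xs)
    case (Cons x xs)
    have "(\<Prod>x\<leftarrow>xs. [:- x, 1:]) \<noteq> 0" by (auto simp: prod_list_zero_iff)
    then have "proots ([:- x, 1:] * (\<Prod>x\<leftarrow>xs. [:- x, 1:]))
        = proots [:- x, 1:] + proots (\<Prod>x\<leftarrow>xs. [:- x, 1:])"
      by (intro proots_mult) auto
    then show ?case using Cons.IH by (simp del: mult_pCons_left)
  qed simp
  from this[of "map (soules_eigenvalue m a b) [0..<n]"]
  have "proots (\<Prod>p\<leftarrow>[0..<n]. [:- soules_eigenvalue m a b p, 1:])
      = mset (map (soules_eigenvalue m a b) [0..<n])"
    by (simp add: o_def)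
  ultimately show ?thesis unfolding has_spectrum_def by simp
qed

section \<open>Nonnegativity of the entries\<close>

lemma offdiagonal_nonneg:
  assumes mono: "\<And>q. 3 \<le> q \<Longrightarrow> Suc q < n \<Longrightarrow> m q \<le> m (Suc q)"
    and top: "m (n - 1) \<le> 1" and p: "3 \<le> p" "p < n"
  shows "m p / (real p + 1) \<le> soules_sum n m p"
proof -
  have "p \<le> n - 1" using p by simp
  then show ?thesis using p(1)
  proof (induction p rule: inc_induct)
    case base
    have "real (n - 1) + 1 = real n" "soules_sum n m (n - 1) = 1 / real n"
      using p soules_sum_last[of "n - 1" m] by auto
    then show ?case using top by (simp add: divide_right_mono)
  next
    case (step q)
    have "m q / (real q + 1) \<le> m (Suc q) / (real q + 1)"
      using mono[of q] step by (intro divide_right_mono) auto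
    also have "\<dots> = m (Suc q) / (real (Suc q) + 1) + m (Suc q) / ((real q + 2) * (real q + 1))"
      by (simp add: divide_simps) (simp add: algebra_simps)
    also have "\<dots> \<le> soules_sum n m q"
      using step soules_sum_Suc[of q n m] by simp
    finally show ?case .
  qed
qed

lemma diagonal_nonneg:
  assumes mono: "\<And>q. 3 \<le> q \<Longrightarrow> Suc q < n \<Longrightarrow> m q \<le> m (Suc q)"
    and bottom: "0 \<le> soules_sum n m 3 + 3 * m 3 / 4" and p: "3 \<le> p" "p < n"
  shows "0 \<le> soules_sum n m p + m p * real p / (real p + 1)"
  using p
proof (induction p rule: nat_induct_at_least)
  case base
  then show ?case using bottom by (simp add: algebra_simps)
next
  case (Suc p)
  have "0 \<le> soules_sum n m p + m p * real p / (real p + 1)" using Suc by simp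
  also have "\<dots> \<le> soules_sum n m p + m (Suc p) * real p / (real p + 1)"
    using mono[of p] Suc by (intro add_left_mono divide_right_mono mult_right_mono) auto
  also have "\<dots> = soules_sum n m (Suc p)
      + (m (Suc p) / ((real p + 2) * (real p + 1)) + m (Suc p) * real p / (real p + 1))"
    using soules_sum_Suc[of p n m] Suc.prems by simp
  also have "m (Suc p) / ((real p + 2) * (real p + 1)) + m (Suc p) * real p / (real p + 1)
      = m (Suc p) * real (Suc p) / (real (Suc p) + 1)"
    by (simp add: divide_simps) (simp add: algebra_simps)
  finally show ?case .
qed

section \<open>The spectrum realized by a doubly stochastic matrix\<close>

theorem theorem4p2:
  fixes n :: nat and l :: "nat \<Rightarrow> real" and a b S :: real
  assumes "n \<ge> 4"
    and "1 \<ge> l 2"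
    and "\<forall>k. 2 \<le> k \<and> k < n - 2 \<longrightarrow> l k \<ge> l (k + 1)"
    and "l (n - 2) \<ge> -1"
    and "1 + (\<Sum>k = 2..n - 2. l k) + 2 * a \<ge> 0"
    and "cmod (complex_of_real a + \<i> * complex_of_real b) \<le> 1"
    and "S = 1 / real n +
           (\<Sum>k = 2..n - 2. l k / ((real n - real k + 2) * (real n - real k + 1)))"
    and "S + 2 * a / 3 \<ge> 0"
    and "S - a / 3 - b * sqrt 3 / 3 \<ge> 0"
    and "S - a / 3 + b * sqrt 3 / 3 \<ge> 0"
    and "1 / real n +
           (\<Sum>k = 2..n - 3. l k / ((real n - real k + 2) * (real n - real k + 1))) +
           3 * l (n - 2) / 4 \<ge> 0"
  shows "\<exists>A. doubly_stochastic n A \<and>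
           has_spectrum A
             (1 # map (\<lambda>k. complex_of_real (l k)) [2..<n - 1] @
              [complex_of_real a + \<i> * complex_of_real b,
               complex_of_real a - \<i> * complex_of_real b])"
proof -
  \<comment> \<open>The Soules vector with index \<open>p\<close> belongs to \<open>k = n + 1 - p\<close>, so that its weight
    \<open>1 / ((p + 1) p)\<close> equals \<open>1 / ((n - k + 2) (n - k + 1))\<close>.\<close>
  define m where "m p = l (n + 1 - p)" for p
  let ?A = "mat n n (\<lambda>(i, j). soules_entry n m a b i j)"
  have n: "4 \<le> n" by fact
  have mono: "m q \<le> m (Suc q)" if q: "3 \<le> q" "Suc q < n" for q
  proof -
    have "2 \<le> n - q \<and> n - q < n - 2" using q by linarith
    then have "l (n - q + 1) \<le> l (n - q)" using assms(3) by blast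
    moreover have "n + 1 - q = n - q + 1" using q by simp
    ultimately show ?thesis by (simp add: m_def)
  qed
  have top: "m (n - 1) \<le> 1" using assms(2) n by (simp add: m_def)
  have reindex: "(\<Sum>k = 2..n - r. l k / ((real n - real k + 2) * (real n - real k + 1)))
      = (\<Sum>q = Suc r..<n. m q / ((real q + 1) * real q))" if "r \<le> n" for r
    by (rule sum.reindex_bij_witness[of _ "\<lambda>q. n + 1 - q" "\<lambda>k. n + 1 - k"])
       (use that n in \<open>auto simp: m_def of_nat_diff algebra_simps\<close>)
  have S: "S = soules_sum n m 2"
    using assms(7) reindex[of 2] n by (simp add: soules_sum_def numeral_3_eq_3 numeral_2_eq_2)
  have bottom: "0 \<le> soules_sum n m 3 + 3 * m 3 / 4"
  proof -
    have "m 3 = l (n - 2)" by (simp add: m_def)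
    then show ?thesis using assms(11) reindex[of 3] n by (simp add: soules_sum_def)
  qed
  have nonneg: "0 \<le> soules_entry n m a b i j" if ij: "i < n" "j < n" for i j
  proof -
    consider "i < 3" "j < 3" | "i = j" "3 \<le> i" | "i \<noteq> j" "3 \<le> max i j" by linarith
    then show ?thesis
    proof cases
      case 1
      then show ?thesis
        using assms(8-10) by (auto simp: soules_entry_def circulant3_def S)
    next
      case 2
      then show ?thesis
        using diagonal_nonneg[OF mono bottom, of i] ij by (simp add: soules_entry_def)
    next
      case 3
      then have "\<not> (i < 3 \<and> j < 3)" "max i j < n" using ij by auto
      then show ?thesis
        using offdiagonal_nonneg[of n m "max i j", OF mono top] 3 by (auto simp: soules_entry_def)
    qed
  qed
  have "doubly_stochastic n ?A"
    unfolding doubly_stochastic_def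
    using nonneg soules_row_sum[of n _ m a b] soules_col_sum[of n _ m a b] n by simp
  moreover have "has_spectrum ?A
     (1 # map (\<lambda>k. complex_of_real (l k)) [2..<n - 1] @
      [complex_of_real a + \<i> * complex_of_real b, complex_of_real a - \<i> * complex_of_real b])"
  proof -
    let ?d = "soules_eigenvalue m a b"
    have "[0..<3] = [0, 1, 2::nat]" by (simp add: numeral_3_eq_3)
    then have "[0..<n] = [0, 1, 2] @ [3..<n]"
      using n upt_add_eq_append[of 0 3 "n - 3"] by simp
    then have "mset (map ?d [0..<n]) = {#?d 0, ?d 1, ?d 2#} + mset (map ?d [3..<n])"
      by simp
    also have "mset (map ?d [3..<n]) = mset (map (\<lambda>k. complex_of_real (l k)) [2..<n - 1])"
    proof -
      have "map ?d [3..<n] = rev (map (\<lambda>k. complex_of_real (l k)) [2..<n - 1])"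
      proof (rule nth_equalityI)
        fix i assume "i < length (map ?d [3..<n])"
        then have i: "i < n - 3" by simp
        then have index: "n + 1 - (3 + i) = 2 + (n - 3 - Suc i)" by simp
        have "rev (map (\<lambda>k. complex_of_real (l k)) [2..<n - 1]) ! i
            = map (\<lambda>k. complex_of_real (l k)) [2..<n - 1] ! (n - 1 - 2 - Suc i)"
          using i by (subst rev_nth) simp_all
        also have "n - 1 - 2 - Suc i = n - 3 - Suc i" by arith
        also have "map (\<lambda>k. complex_of_real (l k)) [2..<n - 1] ! (n - 3 - Suc i)
            = complex_of_real (l ([2..<n - 1] ! (n - 3 - Suc i)))"
          using i by (intro nth_map) simp
        also have "[2..<n - 1] ! (n - 3 - Suc i) = n + 1 - (3 + i)"
          unfolding index using i by (intro nth_upt) simp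
        finally show "map ?d [3..<n] ! i = rev (map (\<lambda>k. complex_of_real (l k)) [2..<n - 1]) ! i"
          using i by (simp add: soules_eigenvalue_def m_def)
      qed auto
      then show ?thesis by (metis mset_rev)
    qed
    also have "{#?d 0, ?d 1, ?d 2#} = {#1, complex_of_real a + \<i> * complex_of_real b,
        complex_of_real a - \<i> * complex_of_real b#}"
      by (simp add: soules_eigenvalue_def)
    finally show ?thesis
      using soules_spectrum[of n m a b] n by (simp add: has_spectrum_def)
  qed
  ultimately show ?thesis by blast
qed

end
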